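(* (i) For any $V\in\mathbb{R}^{n\times r}$, define $V'=V-\frac{ee_1^\top}{2}$. If there exists an optimal solution $\Theta\in\mathbb{R}^{m\times r}$ of the problem $$\min_{\Theta\in\mathbb{R}^{m\times r}}\ G(\Theta):=\sum_{i\in B}\|(V'+A^\top\Theta)_i\|+\sum_{i\in[n]\setminus B}\|(V'+A^\top\Theta)_i\|^2+\langle(Ae-2b)e_1^\top,\Theta\rangle\qquad( * )$$ such that every row of $(V'+A^\top\Theta)_B$ is non-zero, then $\operatorname{Proj}_{\mathcal{M}_r}(V)=\operatorname{Proj}_{\mathcal{B}_r}(V+A^\top\Theta)$. (ii) For any regular point $R\in\mathcal{M}_r$, there exists $\epsilon>0$ such that for any $V\in\mathrm{B}_\epsilon(R)$, $\operatorname{Proj}_{\mathcal{M}_r}(V)=\operatorname{Proj}_{\mathcal{B}_r}(V+A^\top\Theta)$ for some optimal solution $\Theta$ of $( * )$ (with $V'=V-\frac{ee_1^\top}{2}$) satisfying that every row of $(V'+A^\top\Theta)_B$ is non-zero.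
   Context: $n,m,r$ are positive integers, $A\in\mathbb{R}^{m\times n}$ has full row rank, $b\in\mathbb{R}^m$ with $b\ge0$, $B\subseteq[n]=\{1,\dots,n\}$. $e\in\mathbb{R}^n$ is the all-ones vector, $e_1\in\mathbb{R}^r$ the first standard unit vector, $\langle X,Y\rangle=\operatorname{Tr}(XY^\top)$. $X_i$ denotes the $i$-th row of $X$ and $X_B$ the submatrix of rows of $X$ indexed by $B$; $\operatorname{diag}_B(X)=(X_{ii})_{i\in B}$. $\mathcal{M}_r=\{R\in\mathbb{R}^{n\times r}: AR=be_1^\top,\ \operatorname{diag}_B(RR^\top)-R_Be_1=0\}$ and $\mathcal{B}_r=\{R\in\mathbb{R}^{n\times r}:\operatorname{diag}_B(RR^\top)-R_Be_1=0\}$. For a closed set $\mathcal S\subseteq\mathbb{R}^{n\times r}$, $\operatorname{Proj}_{\mathcal S}(V)=\arg\min\{\|R-V\|_F^2:R\in\mathcal S\}$ is the metric projection (a set in general, identified with its single element when the minimizer is unique). A point $R\in\mathcal{M}_r$ is regular if the gradients at $R$ of the $mr+|B|$ scalar constraint functions defining $\mathcal{M}_r$ are linearly independent (LICQ), equivalently if the linear map $(\lambda,\mu)\mapsto A^\top\lambda+\operatorname{diag}_B^*(\mu)(2R-ee_1^\top)$ on $\mathbb{R}^{m\times r}\times\mathbb{R}^{|B|}$ is injective, where $\operatorname{diag}_B^*(\mu)\in\mathbb{R}^{n\times n}$ is the diagonal matrix with the entries of $\mu$ at positions in $B$ and $0$ elsewhere. $\mathrm{B}_\epsilon(R)$ is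 the open ball in $\mathbb{R}^{n\times r}$ of radius $\epsilon$ around $R$ in Frobenius norm. *)

theory Defs
  imports "HOL-Analysis.Analysis"
begin

text \<open>
  A real \<open>p \<times> q\<close> matrix has type \<^typ>\<open>real^'q^'p\<close>. On this type the library's
  inner product, norm, distance and open ball are the Frobenius ones.
\<close>

definition ones :: "real^'n" where
  "ones = (\<chi> i. 1)"

text \<open>The column index type is linearly ordered only so that it has a first index.\<close>

definition e1 :: "real^'r::{finite,linorder}" where
  "e1 = axis (Min UNIV) 1"

definition outer :: "real^'p \<Rightarrow> real^'q \<Rightarrow> real^'q^'p" where
  "outer u v = (\<chi> i j. u $ i * v $ j)"

text \<open>The constraint \<open>diag\<^sub>B(R R\<^sup>T) - R\<^sub>B e\<^sub>1 = 0\<close> is imposed entrywise, at the indices \<open>i \<in> B\<close>.\<close>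

definition diag_constraint :: "'n \<Rightarrow> real^'r::{finite,linorder}^'n \<Rightarrow> real" where
  "diag_constraint i R = (R ** transpose R) $ i $ i - (R *v e1) $ i"

definition lin_constraint ::
  "real^'n^'m \<Rightarrow> real^'m \<Rightarrow> 'm \<Rightarrow> 'r::{finite,linorder} \<Rightarrow> real^'r::{finite,linorder}^'n \<Rightarrow> real" where
  "lin_constraint A b j k R = (A ** R - outer b e1) $ j $ k"

definition Bset :: "'n set \<Rightarrow> (real^'r::{finite,linorder}^'n) set" where
  "Bset B = {R. \<forall>i\<in>B. diag_constraint i R = 0}"

definition Mset ::
  "real^'n^'m \<Rightarrow> real^'m \<Rightarrow> 'n set \<Rightarrow> (real^'r::{finite,linorder}^'n) set" where
  "Mset A b B = {R. A ** R = outer b e1 \<and> (\<forall>i\<in>B. diag_constraint i R = 0)}"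

definition Proj :: "(real^'r^'n) set \<Rightarrow> real^'r^'n \<Rightarrow> (real^'r^'n) set" where
  "Proj S V = {R. is_arg_min (\<lambda>R. (norm (R - V))\<^sup>2) (\<lambda>R. R \<in> S) R}"

definition gradient :: "('a::real_inner \<Rightarrow> real) \<Rightarrow> 'a \<Rightarrow> 'a" where
  "gradient f x = (THE D. GDERIV f x :> D)"

text \<open>
  The scalar constraint functions defining \<open>Mset A b B\<close>, indexed by
  the disjoint sum of \<open>'m \<times> 'r\<close> and \<open>B\<close>.
\<close>

fun constraint ::
  "real^'n^'m \<Rightarrow> real^'m \<Rightarrow> ('m \<times> 'r::{finite,linorder}) + 'n \<Rightarrow> real^'r::{finite,linorder}^'n \<Rightarrow> real" where
  "constraint A b (Inl (j, k)) = lin_constraint A b j k"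
| "constraint A b (Inr i) = diag_constraint i"

text \<open>
  LICQ concerns the indexed family of gradients, so injectivity is required in addition to
  linear independence of the set of gradients.
\<close>

definition regular_point ::
  "real^'n^'m \<Rightarrow> real^'m \<Rightarrow> 'n set \<Rightarrow> real^'r::{finite,linorder}^'n \<Rightarrow> bool" where
  "regular_point A b B R \<longleftrightarrow>
     R \<in> Mset A b B \<and>
     inj_on (\<lambda>c. gradient (constraint A b c) R) (UNIV <+> B) \<and>
     independent ((\<lambda>c. gradient (constraint A b c) R) ` (UNIV <+> B))"

definition shift :: "real^'r::{finite,linorder}^'n \<Rightarrow> real^'r::{finite,linorder}^'n" where
  "shift V = V - (1 / 2) *\<^sub>R outer ones e1"

definition G ::
  "real^'n^'m \<Rightarrow> real^'m \<Rightarrow> 'n set \<Rightarrow> real^'r::{finite,linorder}^'n \<Rightarrow> real^'r::{finite,linorder}^'m \<Rightarrow> real" where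
  "G A b B V \<Theta> =
     (\<Sum>i\<in>B. norm (row i (shift V + transpose A ** \<Theta>)))
     + (\<Sum>i\<in>UNIV - B. (norm (row i (shift V + transpose A ** \<Theta>)))\<^sup>2)
     + trace (outer (A *v ones - 2 *\<^sub>R b) e1 ** transpose \<Theta>)"

definition optimal ::
  "real^'n^'m \<Rightarrow> real^'m \<Rightarrow> 'n set \<Rightarrow> real^'r::{finite,linorder}^'n \<Rightarrow> real^'r::{finite,linorder}^'m \<Rightarrow> bool" where
  "optimal A b B V \<Theta> \<longleftrightarrow> is_arg_min (G A b B V) (\<lambda>_. True) \<Theta>"

definition nonzero_rows ::
  "real^'n^'m \<Rightarrow> 'n set \<Rightarrow> real^'r::{finite,linorder}^'n \<Rightarrow> real^'r::{finite,linorder}^'m \<Rightarrow> bool" where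
  "nonzero_rows A B V \<Theta> \<longleftrightarrow> (\<forall>i\<in>B. row i (shift V + transpose A ** \<Theta>) \<noteq> 0)"

end

theory Submission
  imports Defs
begin

text \<open>
  Put \<open>S = shift R\<close>. Completing the square turns the constraint at a row \<open>i \<in> B\<close> into
  \<open>norm (S $ i) = 1/2\<close>, so \<open>Bset B\<close> is, up to a translation, a product of spheres and full spaces.
  The projection of \<open>W\<close> onto it is explicit and unique as soon as the rows of \<open>shift W\<close> in \<open>B\<close>
  do not vanish: those rows are rescaled to length \<open>1/2\<close> (\<open>Proj_Bset\<close>).

  Minimising \<open>G\<close> is a dual problem for the constraint \<open>A ** R = outer b e1\<close>. Where \<open>G\<close> is
  differentiable, its gradient at \<open>\<Theta>\<close> is twice the residual of that constraint at the projection
  of \<open>W = V + transpose A ** \<Theta>\<close> onto \<open>Bset B\<close>. An optimal \<open>\<Theta>\<close> with non-zero rows therefore makes this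
  projection an element of \<open>Mset A b B\<close>. On \<open>Mset A b B\<close> the squared distances to \<open>V\<close> and to \<open>W\<close>
  differ by a constant, since \<open>A ** R\<close> is constant there, so the point that is closest to
  \<open>W\<close> in the larger set is also the one closest to \<open>V\<close> in the smaller set. This is the first part.

  For the second part, let \<open>R\<close> be regular and \<open>V = R\<close>. Feasibility of \<open>R\<close> makes
  \<open>\<Theta> = 0\<close> a minimiser of \<open>G\<close>: the increment of \<open>G\<close> is a sum of multiples of
  Cauchy--Schwarz defects and of squares (\<open>G_increment\<close>). If it vanishes, each row of \<open>transpose A ** \<Theta>\<close> in \<open>B\<close> is parallel to
  the row of \<open>shift R\<close> and all other rows are zero, which is exactly a linear relation
  between the constraint gradients; by regularity \<open>\<Theta> = 0\<close>. So the minimiser is strict, and a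
  strict minimiser of a convex function persists near its original position under
  small perturbations (\<open>strict_convex_minimiser_persists\<close>).
  Non-vanishing of rows is an open condition that holds at \<open>V = R\<close>, \<open>\<Theta> = 0\<close>,
  where the rows have length \<open>1/2\<close>, so the first part applies to every \<open>V\<close> near \<open>R\<close>.
\<close>

section \<open>Stability of strict minimisers of convex functions\<close>

text \<open>
  On a small sphere around the strict minimiser \<open>y0\<close> the inequality \<open>f x0 y > f x0 y0\<close> survives, by
  compactness, for all \<open>x\<close> near \<open>x0\<close>. A minimiser over the closed ball then beats the points outside
  the ball too, because a convex function that has grown at the sphere does not fall below
  its central value further out.
\<close>

lemma strict_convex_minimiser_persists:
  fixes f :: "'a::metric_space \<Rightarrow> 'b::euclidean_space \<Rightarrow> real"
  assumes cont: "continuous_on UNIV (\<lambda>p. f (fst p) (snd p))"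
    and conv: "\<And>x. convex_on UNIV (f x)"
    and strict: "\<And>y. y \<noteq> y0 \<Longrightarrow> f x0 y0 < f x0 y"
    and "\<delta> > 0"
  shows "\<exists>\<epsilon>>0. \<forall>x\<in>ball x0 \<epsilon>. \<exists>y\<in>cball y0 \<delta>. \<forall>z. f x y \<le> f x z"
proof -
  have cont0: "continuous_on UNIV (\<lambda>p. f (fst p) y0)"
    by (rule continuous_on_compose2[OF cont, of _ "\<lambda>p. (fst p, y0)", simplified])
       (intro continuous_intros)
  have op: "open {p. f (fst p) y0 < f (fst p) (snd p)}"
    by (rule open_Collect_less[OF cont0 cont])
  have "f x0 y0 < f x0 y" if "y \<in> sphere y0 \<delta>" for y
    using strict[of y] that \<open>\<delta> > 0\<close> by (cases "y = y0") simp_all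
  then have "{x0} \<times> sphere y0 \<delta> \<subseteq> {p. f (fst p) y0 < f (fst p) (snd p)}"
    by auto
  from Elementary_Topology.tube_lemma[OF compact_sphere op this] obtain X where X: "x0 \<in> X" "open X"
      "X \<times> sphere y0 \<delta> \<subseteq> {p. f (fst p) y0 < f (fst p) (snd p)}"
    by (elim exE conjE)
  obtain \<epsilon> where \<epsilon>: "\<epsilon> > 0" "ball x0 \<epsilon> \<subseteq> X"
    using X(1,2) open_contains_ball by blast
  have "\<exists>y\<in>cball y0 \<delta>. \<forall>z. f x y \<le> f x z" if x: "x \<in> ball x0 \<epsilon>" for x
  proof -
    have sphere: "f x y0 < f x y" if "dist y0 y = \<delta>" for y
      using X(3) \<epsilon>(2) x that by (auto simp: subset_iff)
    have "continuous_on (cball y0 \<delta>) (f x)"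
      by (rule continuous_on_compose2[OF cont, of _ "\<lambda>y. (x, y)", simplified])
         (intro continuous_intros)
    then obtain y where y: "y \<in> cball y0 \<delta>" "\<And>z. z \<in> cball y0 \<delta> \<Longrightarrow> f x y \<le> f x z"
      using continuous_attains_inf[of "cball y0 \<delta>" "f x"] \<open>\<delta> > 0\<close> by auto
    have "f x y \<le> f x z" for z
    proof (cases "z \<in> cball y0 \<delta>")
      case False
      then have d: "dist y0 z > \<delta>" by simp
      define t where "t = \<delta> / dist y0 z"
      have t: "0 < t" "t < 1"
        unfolding t_def using d \<open>\<delta> > 0\<close> by (auto intro!: divide_pos_pos simp: divide_less_eq)
      have eq: "y0 - ((1 - t) *\<^sub>R y0 + t *\<^sub>R z) = t *\<^sub>R (y0 - z)"
        by (simp add: algebra_simps)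
      have "dist y0 ((1 - t) *\<^sub>R y0 + t *\<^sub>R z) = t * dist y0 z"
        using t(1) unfolding dist_norm eq by simp
      also have "\<dots> = \<delta>"
        using d \<open>\<delta> > 0\<close> by (auto simp: t_def)
      finally have "f x y0 < f x ((1 - t) *\<^sub>R y0 + t *\<^sub>R z)"
        by (rule sphere)
      also have "\<dots> \<le> (1 - t) * f x y0 + t * f x z"
        using convex_onD[OF conv, of t y0 z x] t by simp
      finally have "t * f x y0 < t * f x z"
        by (simp add: algebra_simps)
      then have "f x y0 < f x z" using t by simp
      moreover have "f x y \<le> f x y0" using y(2)[of y0] \<open>\<delta> > 0\<close> by simp
      ultimately show ?thesis by simp
    qed (use y in auto)
    with y(1) show ?thesis by blast
  qed
  with \<epsilon>(1) show ?thesis by blast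
qed

section \<open>Rows, the shift and the Frobenius inner product\<close>

lemma row_eq_nth: "row i M = M $ i"
  by (simp add: row_def vec_lambda_eta)

lemma norm_e1 [simp]: "norm (e1 :: real^'r::{finite,linorder}) = 1"
  by (simp add: e1_def)

lemma outer_nth: "outer u v $ i = u $ i *\<^sub>R v"
  by (simp add: outer_def vec_eq_iff)

lemma shift_nth: "shift V $ i = V $ i - (1/2) *\<^sub>R e1"
  by (simp add: shift_def outer_nth ones_def)

lemma shift_add: "shift (V + X) = shift V + X"
  by (simp add: shift_def)

lemma trace_mult_transpose: "trace (X ** transpose Y) = X \<bullet> (Y :: real^'q^'p)"
  by (simp add: trace_def matrix_matrix_mult_def transpose_def inner_vec_def)

lemma transpose_mult_nth:
  "(transpose A ** \<Theta>) $ i = (\<Sum>j\<in>UNIV. A $ j $ i *\<^sub>R (\<Theta> :: real^'r^'m) $ j)"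
  by (simp add: vec_eq_iff matrix_matrix_mult_def transpose_def)

lemma inner_transpose_mult:
  fixes A :: "real^'n^'m"
  shows "(transpose A ** \<Theta>) \<bullet> X = \<Theta> \<bullet> (A ** (X :: real^'r^'n))"
proof -
  have "(transpose A ** \<Theta>) \<bullet> X = (\<Sum>i\<in>UNIV. \<Sum>j\<in>UNIV. A $ j $ i * (\<Theta> $ j \<bullet> X $ i))"
    unfolding inner_vec_def[of "transpose A ** \<Theta>"] transpose_mult_nth
    by (simp add: inner_sum_left)
  also have "\<dots> = (\<Sum>j\<in>UNIV. \<Theta> $ j \<bullet> (\<Sum>i\<in>UNIV. A $ j $ i *\<^sub>R X $ i))"
    by (subst sum.swap) (simp add: inner_sum_right)
  also have "(\<lambda>j. \<Sum>i\<in>UNIV. A $ j $ i *\<^sub>R X $ i) = (\<lambda>j. (A ** X) $ j)"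
    by (simp add: fun_eq_iff vec_eq_iff matrix_matrix_mult_def)
  finally show ?thesis by (simp add: inner_vec_def)
qed

lemma bounded_linear_transpose_mult_nth:
  "bounded_linear (\<lambda>\<Theta> :: real^'r^'m. (transpose A ** \<Theta>) $ i)"
  unfolding linear_conv_bounded_linear[symmetric] transpose_mult_nth
  by (intro linearI) (simp_all add: algebra_simps sum.distrib scaleR_sum_right)

lemma matrix_vector_mult_nth_inner: "((M :: real^'q^'p) *v v) $ i = M $ i \<bullet> v"
  by (simp add: matrix_vector_mult_def inner_vec_def)

lemma diag_constraint_inner: "diag_constraint i R = R $ i \<bullet> R $ i - R $ i \<bullet> e1"
  unfolding diag_constraint_def matrix_vector_mult_nth_inner
  by (simp add: matrix_matrix_mult_def transpose_def inner_vec_def)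

lemma diag_constraint_iff:
  fixes R :: "real^'r::{finite,linorder}^'n"
  shows "diag_constraint i R = 0 \<longleftrightarrow> norm (shift R $ i) = 1/2"
proof -
  have "norm (e1 :: real^'r::{finite,linorder}) ^ 2 = 1" by simp
  then have "e1 \<bullet> (e1 :: real^'r::{finite,linorder}) = 1" by (simp only: power2_norm_eq_inner)
  then have "(norm (shift R $ i))\<^sup>2 = diag_constraint i R + (1/2)\<^sup>2"
    by (simp add: power2_norm_eq_inner shift_nth diag_constraint_inner algebra_simps
        inner_commute power_divide)
  then show ?thesis
    by (metis add_0 add_cancel_left_left norm_ge_zero power2_eq_iff_nonneg zero_le_divide_1_iff
        zero_le_numeral)
qed

lemma mult_shift_outer_ones:
  "A ** shift R = A ** R - (1/2) *\<^sub>R outer (A *v ones) e1"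
  by (simp add: vec_eq_iff matrix_matrix_mult_def shift_nth outer_def matrix_vector_mult_def
      ones_def right_diff_distrib sum_subtractf sum_distrib_right sum_distrib_left mult_ac)

text \<open>The right-hand side is the form in which the linear constraint appears in the gradient of \<open>G\<close>:
  the vector \<open>A *v ones - 2 *\<^sub>R b\<close> is the one that defines the linear term there.\<close>

lemma lin_constraint_shift_iff:
  "A ** R = outer b e1 \<longleftrightarrow> 2 *\<^sub>R (A ** shift R) + outer (A *v ones - 2 *\<^sub>R b) e1 = 0"
proof -
  have "2 *\<^sub>R (A ** shift R) + outer (A *v ones - 2 *\<^sub>R b) e1 = 2 *\<^sub>R (A ** R - outer b e1)"
    unfolding mult_shift_outer_ones by (simp add: vec_eq_iff outer_def algebra_simps)
  then show ?thesis by simp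
qed

lemma G_rows:
  "G A b B V \<Theta> =
     (\<Sum>i\<in>B. norm (shift V $ i + (transpose A ** \<Theta>) $ i))
     + (\<Sum>i\<in>UNIV - B. (norm (shift V $ i + (transpose A ** \<Theta>) $ i))\<^sup>2)
     + outer (A *v ones - 2 *\<^sub>R b) e1 \<bullet> \<Theta>"
  by (simp add: G_def row_eq_nth trace_mult_transpose)

lemma nonzero_rows_iff:
  "nonzero_rows A B V \<Theta> \<longleftrightarrow> (\<forall>i\<in>B. shift V $ i + (transpose A ** \<Theta>) $ i \<noteq> 0)"
  by (simp add: nonzero_rows_def row_eq_nth)

section \<open>Projection onto the product of spheres\<close>

definition rescale_rows :: "'n set \<Rightarrow> real^'r^'n \<Rightarrow> real^'r^'n" where
  "rescale_rows B W = (\<chi> i. if i \<in> B then (1/2) *\<^sub>R sgn (W $ i) else W $ i)"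

definition Bset_point :: "'n set \<Rightarrow> real^'r::{finite,linorder}^'n \<Rightarrow> real^'r::{finite,linorder}^'n" where
  "Bset_point B W = rescale_rows B (shift W) + (1/2) *\<^sub>R outer ones e1"

lemma shift_Bset_point: "shift (Bset_point B W) = rescale_rows B (shift W)"
  by (simp add: shift_def Bset_point_def)

lemma sphere_projection_identity:
  fixes s w :: "'a::real_inner"
  assumes "norm s = 1/2" "w \<noteq> 0"
  shows "(norm (s - w))\<^sup>2 = (norm ((1/2) *\<^sub>R sgn w - w))\<^sup>2
           + 2 * norm w * (norm (s - (1/2) *\<^sub>R sgn w))\<^sup>2"
proof -
  define n where "n = (1/2) *\<^sub>R sgn w"
  have w: "w = (2 * norm w) *\<^sub>R n"
    using assms(2) by (simp add: n_def sgn_div_norm)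
  have s: "s \<bullet> s = 1/4"
    unfolding power2_norm_eq_inner[symmetric] assms(1) by (simp add: power2_eq_square)
  have half: "norm n = 1/2" using assms(2) by (simp add: n_def norm_sgn)
  have n: "n \<bullet> n = 1/4"
    unfolding power2_norm_eq_inner[symmetric] half by (simp add: power2_eq_square)
  have key: "(norm (s - c *\<^sub>R n))\<^sup>2 = (norm (n - c *\<^sub>R n))\<^sup>2 + c * (norm (s - n))\<^sup>2" for c
    by (simp add: power2_norm_eq_inner inner_diff_left inner_diff_right inner_commute s n
        algebra_simps)
  show ?thesis
    using key[of "2 * norm w"] unfolding w[symmetric] unfolding n_def .
qed

lemma power2_norm_sum_rows: "(norm (X :: real^'r^'n))\<^sup>2 = (\<Sum>i\<in>UNIV. (norm (X $ i))\<^sup>2)"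
  by (simp add: power2_norm_eq_inner inner_vec_def)

text \<open>
  The identity behind both minimality and uniqueness of the projection: on \<open>Bset B\<close>, the squared
  distance to \<open>W\<close> exceeds that of \<open>Bset_point B W\<close> by a sum of squares with positive weights.
\<close>

lemma Bset_distance:
  fixes R W :: "real^'r::{finite,linorder}^'n"
  assumes "\<forall>i\<in>B. shift W $ i \<noteq> 0" "R \<in> Bset B"
  shows "(norm (R - W))\<^sup>2 = (norm (Bset_point B W - W))\<^sup>2 +
    (\<Sum>i\<in>UNIV. (if i \<in> B then 2 * norm (shift W $ i) else 1) * (norm (R $ i - Bset_point B W $ i))\<^sup>2)"
proof -
  have "(norm ((R - W) $ i))\<^sup>2 = (norm ((Bset_point B W - W) $ i))\<^sup>2 +
      (if i \<in> B then 2 * norm (shift W $ i) else 1) * (norm (R $ i - Bset_point B W $ i))\<^sup>2" for i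
  proof -
    have diff: "X $ i - Y $ i = shift X $ i - shift Y $ i" for X Y :: "real^'r::{finite,linorder}^'n"
      by (simp add: shift_nth)
    show ?thesis
      unfolding vector_minus_component diff[of R W] diff[of "Bset_point B W" W] diff[of R "Bset_point B W"]
        shift_Bset_point
      using assms sphere_projection_identity[of "shift R $ i" "shift W $ i"]
      by (simp add: Bset_def rescale_rows_def diag_constraint_iff)
  qed
  then show ?thesis by (simp add: power2_norm_sum_rows sum.distrib)
qed

lemma Bset_point_in_Bset:
  assumes "\<forall>i\<in>B. shift W $ i \<noteq> 0"
  shows "Bset_point B W \<in> Bset B"
  using assms by (simp add: Bset_def diag_constraint_iff shift_Bset_point rescale_rows_def norm_sgn)

lemma Bset_point_strictly_closest:
  assumes "\<forall>i\<in>B. shift W $ i \<noteq> 0" "R \<in> Bset B" "R \<noteq> Bset_point B W"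
  shows "(norm (Bset_point B W - W))\<^sup>2 < (norm (R - W))\<^sup>2"
proof -
  obtain i where "R $ i \<noteq> Bset_point B W $ i"
    using assms(3) by (auto simp: vec_eq_iff)
  then have "0 < (\<Sum>i\<in>UNIV. (if i \<in> B then 2 * norm (shift W $ i) else 1) *
      (norm (R $ i - Bset_point B W $ i))\<^sup>2)"
    using assms(1) by (intro sum_pos2[of _ i]) auto
  with Bset_distance[OF assms(1,2)] show ?thesis by simp
qed

lemma Proj_eq_singletonI:
  assumes "P \<in> S" "\<And>R. R \<in> S \<Longrightarrow> R \<noteq> P \<Longrightarrow> (norm (P - V))\<^sup>2 < (norm (R - V))\<^sup>2"
  shows "Proj S V = {P}"
proof -
  have "is_arg_min (\<lambda>R. (norm (R - V))\<^sup>2) (\<lambda>R. R \<in> S) R \<longleftrightarrow> R = P" for R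
    unfolding is_arg_min_def using assms by (metis less_asym)
  then show ?thesis by (simp add: Proj_def)
qed

lemma Proj_Bset:
  assumes "\<forall>i\<in>B. shift W $ i \<noteq> 0"
  shows "Proj (Bset B) W = {Bset_point B W}"
  using assms by (intro Proj_eq_singletonI Bset_point_in_Bset Bset_point_strictly_closest)

section \<open>Optimal multipliers give the projection\<close>

lemma G_has_derivative:
  assumes "nonzero_rows A B V \<Theta>"
  shows "(G A b B V has_derivative (\<lambda>H.
     (2 *\<^sub>R (A ** rescale_rows B (shift V + transpose A ** \<Theta>)) + outer (A *v ones - 2 *\<^sub>R b) e1) \<bullet> H))
     (at \<Theta>)"
proof -
  let ?W = "\<lambda>i \<Theta>. shift V $ i + (transpose A ** \<Theta>) $ i"
  let ?N = "rescale_rows B (shift V + transpose A ** \<Theta>)"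
  have aff: "(?W i has_derivative (\<lambda>H. (transpose A ** H) $ i)) (at \<Theta>)" for i
    using has_derivative_add[OF has_derivative_const
        bounded_linear_imp_has_derivative[OF bounded_linear_transpose_mult_nth[of A i]]] by simp
  have B: "((\<lambda>\<Theta>. norm (?W i \<Theta>)) has_derivative (\<lambda>H. 2 * ((transpose A ** H) $ i \<bullet> ?N $ i))) (at \<Theta>)"
    if "i \<in> B" for i
    using has_derivative_compose[OF aff[of i] has_derivative_norm[of "?W i \<Theta>"]] assms that
    by (simp add: nonzero_rows_iff rescale_rows_def)
  have notB: "((\<lambda>\<Theta>. (norm (?W i \<Theta>))\<^sup>2) has_derivative
      (\<lambda>H. 2 * ((transpose A ** H) $ i \<bullet> ?N $ i))) (at \<Theta>)"
    if "i \<in> UNIV - B" for i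
    using has_derivative_inner[OF aff[of i] aff[of i]] that
    by (simp add: power2_norm_eq_inner rescale_rows_def inner_commute)
  have "(G A b B V has_derivative (\<lambda>H. (\<Sum>i\<in>B. 2 * ((transpose A ** H) $ i \<bullet> ?N $ i))
      + (\<Sum>i\<in>UNIV - B. 2 * ((transpose A ** H) $ i \<bullet> ?N $ i))
      + outer (A *v ones - 2 *\<^sub>R b) e1 \<bullet> H)) (at \<Theta>)"
    unfolding G_rows
    by (intro has_derivative_add has_derivative_sum B notB has_derivative_inner_right has_derivative_ident)
  moreover have "(\<Sum>i\<in>B. 2 * ((transpose A ** H) $ i \<bullet> ?N $ i))
      + (\<Sum>i\<in>UNIV - B. 2 * ((transpose A ** H) $ i \<bullet> ?N $ i)) = 2 * ((transpose A ** H) \<bullet> ?N)" for H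
    using sum.subset_diff[of B UNIV "\<lambda>i. 2 * ((transpose A ** H) $ i \<bullet> ?N $ i)"]
    by (simp add: inner_vec_def[of "transpose A ** H"] sum_distrib_left)
  ultimately show ?thesis
    by (simp add: inner_transpose_mult inner_add_left inner_add_right inner_commute)
qed

lemma optimal_imp_feasible:
  assumes "optimal A b B V \<Theta>" "nonzero_rows A B V \<Theta>"
  shows "Bset_point B (V + transpose A ** \<Theta>) \<in> Mset A b B"
proof -
  let ?D = "2 *\<^sub>R (A ** rescale_rows B (shift V + transpose A ** \<Theta>)) + outer (A *v ones - 2 *\<^sub>R b) e1"
  have "\<forall>\<Theta>'. G A b B V \<Theta> \<le> G A b B V \<Theta>'"
    using assms(1) by (auto simp: optimal_def is_arg_min_linorder)
  then have "(\<lambda>H. ?D \<bullet> H) = (\<lambda>H. 0)"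
    using differential_zero_maxmin[OF _ open_UNIV G_has_derivative[OF assms(2)]] by blast
  then have "?D = 0" by (metis inner_eq_zero_iff)
  moreover have "Bset_point B (V + transpose A ** \<Theta>) \<in> Bset B"
    using assms(2) by (intro Bset_point_in_Bset) (simp add: nonzero_rows_iff shift_add)
  ultimately show ?thesis
    by (simp add: Mset_def Bset_def lin_constraint_shift_iff shift_Bset_point shift_add)
qed

text \<open>
  Translating \<open>V\<close> by an element of the range of \<open>transpose A\<close>, that is, orthogonally to the kernel of
  the linear constraint, changes all squared distances to feasible points by the same amount.
\<close>

lemma translation_preserves_distance_gap:
  fixes A :: "real^'n^'m" and R :: "real^'r^'n"
  assumes "A ** R = A ** R'"
  shows "(norm (R - V))\<^sup>2 - (norm (R' - V))\<^sup>2 =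
     (norm (R - (V + transpose A ** \<Theta>)))\<^sup>2 - (norm (R' - (V + transpose A ** \<Theta>)))\<^sup>2"
proof -
  have "(transpose A ** \<Theta>) \<bullet> R = (transpose A ** \<Theta>) \<bullet> R'"
    using assms by (simp add: inner_transpose_mult)
  then show ?thesis
    by (simp add: power2_norm_eq_inner inner_diff_left inner_diff_right inner_add_left
        inner_add_right inner_commute algebra_simps)
qed

lemma Proj_Mset_eq_Proj_Bset:
  assumes "optimal A b B V \<Theta>" "nonzero_rows A B V \<Theta>"
  shows "Proj (Mset A b B) V = Proj (Bset B) (V + transpose A ** \<Theta>)"
proof -
  let ?W = "V + transpose A ** \<Theta>"
  let ?P = "Bset_point B ?W"
  have nz: "\<forall>i\<in>B. shift ?W $ i \<noteq> 0"
    using assms(2) by (simp add: nonzero_rows_iff shift_add)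
  have P: "?P \<in> Mset A b B" by (rule optimal_imp_feasible[OF assms])
  have "(norm (?P - V))\<^sup>2 < (norm (R - V))\<^sup>2" if R: "R \<in> Mset A b B" "R \<noteq> ?P" for R
  proof -
    have "R \<in> Bset B" "A ** R = A ** ?P"
      using R P by (simp_all add: Mset_def Bset_def)
    with Bset_point_strictly_closest[OF nz, of R] translation_preserves_distance_gap[of A R ?P V \<Theta>] R(2)
    show ?thesis by simp
  qed
  with P have "Proj (Mset A b B) V = {?P}" by (rule Proj_eq_singletonI)
  then show ?thesis by (simp add: Proj_Bset[OF nz])
qed

section \<open>Gradients of the constraints\<close>

lemma gradient_eqI: "GDERIV f x :> D \<Longrightarrow> gradient f x = D"
  unfolding gradient_def
proof (rule the_equality)
  fix D' assume "GDERIV f x :> D" "GDERIV f x :> D'"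
  then have "(\<lambda>h. h \<bullet> D') = (\<lambda>h. h \<bullet> D)"
    unfolding gderiv_def by (rule has_derivative_unique[rotated])
  then show "D' = D" by (metis vector_eq_ldot)
qed

lemma gradient_lin_constraint:
  "gradient (lin_constraint A b j k) R = (\<chi> i. A $ j $ i *\<^sub>R axis k 1)"
proof (rule gradient_eqI)
  let ?D = "(\<chi> i. A $ j $ i *\<^sub>R axis k 1)"
  have "lin_constraint A b j k = (\<lambda>R. R \<bullet> ?D - outer b e1 $ j $ k)"
    by (simp add: fun_eq_iff lin_constraint_def matrix_matrix_mult_def inner_vec_def[of _ ?D] inner_axis)
  then show "GDERIV (lin_constraint A b j k) R :> ?D"
    unfolding gderiv_def by (auto intro!: derivative_eq_intros)
qed

lemma gradient_diag_constraint:
  "gradient (diag_constraint i) R = axis i (2 *\<^sub>R R $ i - e1)"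
proof (rule gradient_eqI)
  have nth: "((\<lambda>R. R $ i) has_derivative (\<lambda>h. h $ i)) (at R)"
    by (rule bounded_linear_imp_has_derivative[OF bounded_linear_vec_nth])
  have "(diag_constraint i has_derivative (\<lambda>h. (R $ i \<bullet> h $ i + h $ i \<bullet> R $ i) - h $ i \<bullet> e1)) (at R)"
    unfolding diag_constraint_inner
    by (intro has_derivative_diff has_derivative_inner nth has_derivative_inner_left)
  then show "GDERIV (diag_constraint i) R :> axis i (2 *\<^sub>R R $ i - e1)"
    unfolding gderiv_def by (simp add: inner_axis inner_diff_right inner_commute)
qed

lemma independent_family_zero_coeffs:
  fixes g :: "'c \<Rightarrow> 'v::real_vector"
  assumes "inj_on g I" "independent (g ` I)" "finite I" "(\<Sum>c\<in>I. u c *\<^sub>R g c) = 0" "c \<in> I"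
  shows "u c = 0"
proof -
  have "(\<Sum>v\<in>g ` I. u (the_inv_into I g v) *\<^sub>R v) = (\<Sum>c\<in>I. u c *\<^sub>R g c)"
    using assms(1) by (simp add: sum.reindex the_inv_into_f_f)
  with assms have "u (the_inv_into I g (g c)) = 0"
    using independentD[OF assms(2), of "g ` I" "\<lambda>v. u (the_inv_into I g v)" "g c"] by simp
  with assms show ?thesis by (simp add: the_inv_into_f_f)
qed

text \<open>
  The hypotheses say that \<open>transpose A ** \<Theta>\<close> is a combination of the gradients of the diagonal
  constraints, while it always is one of the gradients of the linear constraints, with the entries of \<open>\<Theta>\<close> as
  coefficients. Linear independence of all these gradients makes the coefficients vanish.
\<close>

lemma regular_point_trivial_kernel:
  fixes \<Theta> :: "real^'r::{finite,linorder}^'m"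
  assumes "regular_point A b B R"
    and inB: "\<And>i. i \<in> B \<Longrightarrow> (transpose A ** \<Theta>) $ i = \<mu> i *\<^sub>R (2 *\<^sub>R R $ i - e1)"
    and notinB: "\<And>i. i \<notin> B \<Longrightarrow> (transpose A ** \<Theta>) $ i = 0"
  shows "\<Theta> = 0"
proof -
  define g where "g = (\<lambda>c. gradient (constraint A b c) R)"
  define u where "u = (\<lambda>c. case c of Inl (j, k) \<Rightarrow> \<Theta> $ j $ k | Inr i \<Rightarrow> - \<mu> i)"
  have lin: "(\<Sum>c\<in>UNIV. u (Inl c) *\<^sub>R g (Inl c)) = transpose A ** \<Theta>"
  proof -
    have "(\<Sum>c\<in>UNIV. u (Inl c) *\<^sub>R g (Inl c)) =
        (\<Sum>j\<in>UNIV. \<Sum>k\<in>UNIV. \<Theta> $ j $ k *\<^sub>R (\<chi> i. A $ j $ i *\<^sub>R axis k 1))"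
      unfolding sum.cartesian_product UNIV_Times_UNIV
      by (intro sum.cong) (auto simp: u_def g_def gradient_lin_constraint)
    also have "\<dots> = transpose A ** \<Theta>"
      by (simp add: vec_eq_iff transpose_mult_nth axis_def if_distrib mult.commute cong: if_cong)
    finally show ?thesis .
  qed
  have diag: "(\<Sum>i\<in>B. u (Inr i) *\<^sub>R g (Inr i)) = - (transpose A ** \<Theta>)"
  proof -
    have "(\<Sum>i\<in>B. u (Inr i) *\<^sub>R g (Inr i)) $ l = - (transpose A ** \<Theta>) $ l" for l
    proof -
      have "(\<Sum>i\<in>B. u (Inr i) *\<^sub>R g (Inr i)) $ l =
          (\<Sum>i\<in>B. if i = l then - \<mu> i *\<^sub>R (2 *\<^sub>R R $ i - e1) else 0)"
        unfolding sum_component by (intro sum.cong) (auto simp: u_def g_def gradient_diag_constraint axis_def)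
      also have "\<dots> = - (transpose A ** \<Theta>) $ l"
        using inB notinB by (cases "l \<in> B") (simp_all add: sum.delta')
      finally show ?thesis .
    qed
    then show ?thesis by (simp add: vec_eq_iff)
  qed
  have "(\<Sum>c\<in>UNIV <+> B. u c *\<^sub>R g c) = 0"
    by (subst sum.Plus) (simp_all add: lin diag)
  then have "u (Inl (j, k)) = 0" for j k
    using assms(1) independent_family_zero_coeffs[of g "UNIV <+> B" u "Inl (j, k)"]
    by (simp add: regular_point_def g_def InlI)
  then show ?thesis by (simp add: u_def vec_eq_iff)
qed

section \<open>The dual objective near a regular point\<close>

lemma continuous_on_G: "continuous_on UNIV (\<lambda>p. G A b B (fst p) (snd p))"
proof -
  have *: "continuous_on UNIV (\<lambda>p. (transpose A ** snd p) $ i)" for i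
    by (intro bounded_linear.continuous_on[OF bounded_linear_transpose_mult_nth] continuous_intros)
  show ?thesis
    unfolding G_rows shift_nth by (intro continuous_intros *)
qed

lemma convex_on_power2_norm: "convex_on UNIV (\<lambda>x :: 'a::real_inner. (norm x)\<^sup>2)"
proof (rule convex_onI)
  fix t :: real and x y :: 'a
  assume t: "0 < t" "t < 1"
  have "(1 - t) * (norm x)\<^sup>2 + t * (norm y)\<^sup>2 - (norm ((1 - t) *\<^sub>R x + t *\<^sub>R y))\<^sup>2
      = (1 - t) * t * (norm (x - y))\<^sup>2"
    by (simp add: power2_norm_eq_inner inner_add_left inner_add_right inner_diff_left inner_diff_right
        inner_commute algebra_simps)
  moreover have "0 \<le> (1 - t) * t * (norm (x - y))\<^sup>2" using t by simp
  ultimately show "(norm ((1 - t) *\<^sub>R x + t *\<^sub>R y))\<^sup>2 \<le> (1 - t) * (norm x)\<^sup>2 + t * (norm y)\<^sup>2"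
    by linarith
qed simp

lemma convex_on_compose_affine:
  assumes "convex_on UNIV f" "linear L"
  shows "convex_on UNIV (\<lambda>x. f (a + L x))"
proof (rule convex_onI)
  fix t :: real and x y
  assume t: "0 < t" "t < 1"
  have "a + L ((1 - t) *\<^sub>R x + t *\<^sub>R y) = (1 - t) *\<^sub>R (a + L x) + t *\<^sub>R (a + L y)"
    by (simp add: linear_add[OF assms(2)] linear_diff[OF assms(2)] linear_scale[OF assms(2)] algebra_simps)
  then show "f (a + L ((1 - t) *\<^sub>R x + t *\<^sub>R y)) \<le> (1 - t) * f (a + L x) + t * f (a + L y)"
    using convex_onD[OF assms(1), of t "a + L x" "a + L y"] t by simp
qed simp

lemma convex_on_G:
  fixes V :: "real^'r::{finite,linorder}^'n"
  shows "convex_on UNIV (G A b B V)"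
proof -
  have L: "linear (\<lambda>\<Theta>. (transpose A ** \<Theta>) $ i)" for i
    using bounded_linear_transpose_mult_nth by (rule bounded_linear.linear)
  have nrm: "convex_on UNIV (norm :: real^'r::{finite,linorder} \<Rightarrow> real)"
    using convex_on_dist[of UNIV "0 :: real^'r::{finite,linorder}"] by simp
  have sums: "convex_on UNIV (\<lambda>\<Theta>. \<Sum>i\<in>I. f (shift V $ i + (transpose A ** \<Theta>) $ i))"
    if "convex_on UNIV f" for I and f :: "real^'r::{finite,linorder} \<Rightarrow> real"
    using finite[of I]
    by induction (auto intro!: convex_on_add convex_on_compose_affine[OF that L] simp: convex_on_const)
  have lin: "convex_on UNIV (\<lambda>\<Theta>. outer (A *v ones - 2 *\<^sub>R b) e1 \<bullet> \<Theta>)"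
    by (rule convex_onI) (simp_all add: inner_add_right)
  show ?thesis
    unfolding G_rows
    by (intro convex_on_add lin sums nrm convex_on_power2_norm)
qed

text \<open>Feasibility of \<open>R\<close> identifies the linear term of \<open>G\<close> with \<open>-2\<close> times the inner product of
  \<open>shift R\<close> with \<open>transpose A ** \<Theta>\<close>, which splits over the rows.\<close>

lemma G_increment:
  fixes A :: "real^'n^'m" and R :: "real^'r::{finite,linorder}^'n"
  assumes "R \<in> Mset A b B"
  shows "G A b B R \<Theta> - G A b B R 0 =
    (\<Sum>i\<in>B. norm (shift R $ i + (transpose A ** \<Theta>) $ i)
             - 2 * (shift R $ i \<bullet> (shift R $ i + (transpose A ** \<Theta>) $ i)))
    + (\<Sum>i\<in>UNIV - B. (norm ((transpose A ** \<Theta>) $ i))\<^sup>2)"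
proof -
  let ?S = "shift R" and ?D = "transpose A ** \<Theta>"
  have "outer (A *v ones - 2 *\<^sub>R b) e1 = - (2 *\<^sub>R (A ** ?S))"
    using assms lin_constraint_shift_iff[of A R b] by (simp add: Mset_def add_eq_0_iff)
  then have "outer (A *v ones - 2 *\<^sub>R b) e1 \<bullet> \<Theta> = - 2 * (?D \<bullet> ?S)"
    by (simp add: inner_transpose_mult inner_commute[of "A ** ?S"])
  also have "\<dots> = (\<Sum>i\<in>UNIV. - 2 * (?S $ i \<bullet> ?D $ i))"
    by (simp add: inner_vec_def[of ?D] sum_distrib_left sum_negf inner_commute[of "?D $ _"])
  also have "\<dots> = (\<Sum>i\<in>B. - 2 * (?S $ i \<bullet> ?D $ i)) + (\<Sum>i\<in>UNIV - B. - 2 * (?S $ i \<bullet> ?D $ i))"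
    using sum.subset_diff[of B UNIV "\<lambda>i. - 2 * (?S $ i \<bullet> ?D $ i)"] by simp
  finally have lin: "outer (A *v ones - 2 *\<^sub>R b) e1 \<bullet> \<Theta> = \<dots>" .
  have half: "norm (?S $ i) = 1/2" if "i \<in> B" for i
    using assms that by (simp add: Mset_def diag_constraint_iff)
  have "norm (?S $ i + ?D $ i) - norm (?S $ i) + - 2 * (?S $ i \<bullet> ?D $ i)
      = norm (?S $ i + ?D $ i) - 2 * (?S $ i \<bullet> (?S $ i + ?D $ i))" if "i \<in> B" for i
    using half[OF that] by (simp add: inner_add_right power2_norm_eq_inner[symmetric] power2_eq_square)
  then have B: "(\<Sum>i\<in>B. norm (?S $ i + ?D $ i)) - (\<Sum>i\<in>B. norm (?S $ i)) + (\<Sum>i\<in>B. - 2 * (?S $ i \<bullet> ?D $ i))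
      = (\<Sum>i\<in>B. norm (?S $ i + ?D $ i) - 2 * (?S $ i \<bullet> (?S $ i + ?D $ i)))"
    unfolding sum_subtractf[symmetric] sum.distrib[symmetric] by (intro sum.cong) auto
  have "(norm (?S $ i + ?D $ i))\<^sup>2 - (norm (?S $ i))\<^sup>2 + - 2 * (?S $ i \<bullet> ?D $ i) = (norm (?D $ i))\<^sup>2" for i
    by (simp add: power2_norm_eq_inner inner_add_left inner_add_right inner_commute)
  then have notB: "(\<Sum>i\<in>UNIV - B. (norm (?S $ i + ?D $ i))\<^sup>2) - (\<Sum>i\<in>UNIV - B. (norm (?S $ i))\<^sup>2)
      + (\<Sum>i\<in>UNIV - B. - 2 * (?S $ i \<bullet> ?D $ i)) = (\<Sum>i\<in>UNIV - B. (norm (?D $ i))\<^sup>2)"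
    unfolding sum_subtractf[symmetric] sum.distrib[symmetric] by (intro sum.cong) auto
  have zero: "(transpose A ** (0 :: real^'r::{finite,linorder}^'m)) $ i = 0" for i
    by (simp add: transpose_mult_nth)
  show ?thesis
    unfolding G_rows lin zero B[symmetric] notB[symmetric] by simp
qed

lemma regular_point_strict_minimiser:
  assumes reg: "regular_point A b B R" and "\<Theta> \<noteq> 0"
  shows "G A b B R 0 < G A b B R \<Theta>"
proof (rule ccontr)
  assume le: "\<not> G A b B R 0 < G A b B R \<Theta>"
  have R: "R \<in> Mset A b B" using reg by (simp add: regular_point_def)
  let ?S = "shift R" and ?D = "transpose A ** \<Theta>"
  let ?d = "\<lambda>i. norm (?S $ i + ?D $ i) - 2 * (?S $ i \<bullet> (?S $ i + ?D $ i))"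
  have half: "norm (?S $ i) = 1/2" if "i \<in> B" for i
    using R that by (simp add: Mset_def diag_constraint_iff)
  have d: "0 \<le> ?d i" if "i \<in> B" for i
    using norm_cauchy_schwarz[of "?S $ i" "?S $ i + ?D $ i"] half[OF that] by simp
  have "(\<Sum>i\<in>B. ?d i) + (\<Sum>i\<in>UNIV - B. (norm (?D $ i))\<^sup>2) \<le> 0"
    using le G_increment[OF R, of \<Theta>] by simp
  moreover have "0 \<le> (\<Sum>i\<in>B. ?d i)" "0 \<le> (\<Sum>i\<in>UNIV - B. (norm (?D $ i))\<^sup>2)"
    using d by (auto intro!: sum_nonneg)
  ultimately have "(\<Sum>i\<in>B. ?d i) = 0" "(\<Sum>i\<in>UNIV - B. (norm (?D $ i))\<^sup>2) = 0"
    by linarith+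
  then have d0: "\<And>i. i \<in> B \<Longrightarrow> ?d i = 0" and D0: "\<And>i. i \<notin> B \<Longrightarrow> ?D $ i = 0"
    using d sum_nonneg_eq_0_iff[of B ?d] sum_nonneg_eq_0_iff[of "UNIV - B" "\<lambda>i. (norm (?D $ i))\<^sup>2"]
    by auto
  \<comment> \<open>Equality in Cauchy--Schwarz; \<open>2 *\<^sub>R R $ i - e1\<close> is twice row \<open>i\<close> of \<open>shift R\<close>.\<close>
  have "?D $ i = (norm (?S $ i + ?D $ i) - 1/2) *\<^sub>R (2 *\<^sub>R R $ i - e1)" if "i \<in> B" for i
  proof -
    have "?S $ i \<bullet> (?S $ i + ?D $ i) = norm (?S $ i) * norm (?S $ i + ?D $ i)"
      using d0[OF that] half[OF that] by simp
    then have "(1/2) *\<^sub>R (?S $ i + ?D $ i) = norm (?S $ i + ?D $ i) *\<^sub>R ?S $ i"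
      using norm_cauchy_schwarz_eq[of "?S $ i" "?S $ i + ?D $ i"] half[OF that] by simp
    then have "2 *\<^sub>R ((1/2) *\<^sub>R (?S $ i + ?D $ i)) = 2 *\<^sub>R (norm (?S $ i + ?D $ i) *\<^sub>R ?S $ i)"
      by (rule arg_cong)
    then have "?D $ i = (norm (?S $ i + ?D $ i) - 1/2) *\<^sub>R (2 *\<^sub>R ?S $ i)"
      by (simp add: algebra_simps eq_diff_eq)
    also have "2 *\<^sub>R ?S $ i = 2 *\<^sub>R R $ i - e1"
      by (simp add: shift_nth scaleR_diff_right)
    finally show ?thesis .
  qed
  then have "\<Theta> = 0" using D0 by (rule regular_point_trivial_kernel[OF reg])
  with \<open>\<Theta> \<noteq> 0\<close> show False by simp
qed

lemma nonzero_rows_near: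
  assumes "R \<in> Mset A b B"
  shows "\<exists>\<delta>>0. \<forall>V\<in>ball R \<delta>. \<forall>\<Theta>\<in>ball 0 \<delta>. nonzero_rows A B V \<Theta>"
proof -
  let ?U = "\<Inter>i\<in>B. {p. shift (fst p) $ i + (transpose A ** snd p) $ i \<noteq> 0}"
  have "continuous_on UNIV (\<lambda>p. shift (fst p) $ i + (transpose A ** snd p) $ i)" for i
    unfolding shift_nth
    by (intro continuous_intros bounded_linear.continuous_on[OF bounded_linear_transpose_mult_nth])
  then have "open ?U"
    by (intro open_INT finite ballI open_Collect_neq continuous_on_const)
  moreover have "(R, 0) \<in> ?U"
    using assms by (auto simp: Mset_def diag_constraint_iff transpose_mult_nth)
  ultimately obtain X Y where XY: "open X" "open Y" "R \<in> X" "0 \<in> Y" "X \<times> Y \<subseteq> ?U"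
    by (rule open_prod_elim) auto
  obtain d where d: "0 < d" "ball R d \<subseteq> X"
    using XY(1,3) open_contains_ball by blast
  obtain e where e: "0 < e" "ball 0 e \<subseteq> Y"
    using XY(2,4) open_contains_ball by blast
  have "nonzero_rows A B V \<Theta>" if "V \<in> ball R (min d e)" "\<Theta> \<in> ball 0 (min d e)" for V \<Theta>
  proof -
    have "V \<in> ball R d" "\<Theta> \<in> ball 0 e" using that by simp_all
    then have "(V, \<Theta>) \<in> ?U" using d(2) e(2) XY(5) by blast
    then show ?thesis by (simp add: nonzero_rows_iff)
  qed
  with d(1) e(1) show ?thesis by (intro exI[of _ "min d e"]) simp
qed

section \<open>The projection theorem\<close>

theorem theorem5:
  fixes A :: "real^'n^'m" and b :: "real^'m" and B :: "'n set"
  assumes "rank A = CARD('m)"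
    and "\<forall>j. 0 \<le> b $ j"
  shows
    "(\<forall>(V :: real^'r::{finite,linorder}^'n) \<Theta>.
        optimal A b B V \<Theta> \<and> nonzero_rows A B V \<Theta> \<longrightarrow>
        Proj (Mset A b B) V = Proj (Bset B) (V + transpose A ** \<Theta>))
     \<and>
     (\<forall>R :: real^'r::{finite,linorder}^'n. regular_point A b B R \<longrightarrow>
        (\<exists>\<epsilon>>0. \<forall>V \<in> ball R \<epsilon>. \<exists>\<Theta>.
           optimal A b B V \<Theta> \<and> nonzero_rows A B V \<Theta> \<and>
           Proj (Mset A b B) V = Proj (Bset B) (V + transpose A ** \<Theta>)))"
proof (intro conjI allI impI)
  fix V :: "real^'r::{finite,linorder}^'n" and \<Theta>
  assume "optimal A b B V \<Theta> \<and> nonzero_rows A B V \<Theta>"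
  then show "Proj (Mset A b B) V = Proj (Bset B) (V + transpose A ** \<Theta>)"
    by (simp add: Proj_Mset_eq_Proj_Bset)
next
  fix R :: "real^'r::{finite,linorder}^'n"
  assume reg: "regular_point A b B R"
  obtain \<delta> where \<delta>: "\<delta> > 0" "\<forall>V\<in>ball R \<delta>. \<forall>\<Theta>\<in>ball 0 \<delta>. nonzero_rows A B V \<Theta>"
    using reg nonzero_rows_near unfolding regular_point_def by blast
  obtain \<epsilon> where \<epsilon>: "\<epsilon> > 0" "\<forall>V\<in>ball R \<epsilon>. \<exists>\<Theta>\<in>cball 0 (\<delta>/2). \<forall>\<Theta>'. G A b B V \<Theta> \<le> G A b B V \<Theta>'"
    using strict_convex_minimiser_persists[where f = "G A b B" and \<delta> = "\<delta>/2", OF continuous_on_G convex_on_G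
        regular_point_strict_minimiser[OF reg]] \<delta>(1) by auto
  have "\<exists>\<Theta>. optimal A b B V \<Theta> \<and> nonzero_rows A B V \<Theta> \<and>
      Proj (Mset A b B) V = Proj (Bset B) (V + transpose A ** \<Theta>)" if V: "V \<in> ball R (min \<delta> \<epsilon>)" for V
  proof -
    obtain \<Theta> where "\<Theta> \<in> cball 0 (\<delta>/2)" "\<forall>\<Theta>'. G A b B V \<Theta> \<le> G A b B V \<Theta>'"
      using bspec[OF \<epsilon>(2), of V] V by auto
    then have "optimal A b B V \<Theta>" "nonzero_rows A B V \<Theta>"
      using \<delta> V by (auto simp: optimal_def is_arg_min_linorder)
    then show ?thesis using Proj_Mset_eq_Proj_Bset by blast
  qed
  then show "\<exists>\<epsilon>>0. \<forall>V\<in>ball R \<epsilon>. \<exists>\<Theta>. optimal A b B V \<Theta> \<and> nonzero_rows A B V \<Theta> \<and>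
      Proj (Mset A b B) V = Proj (Bset B) (V + transpose A ** \<Theta>)"
    using \<delta>(1) \<epsilon>(1) by (intro exI[of _ "min \<delta> \<epsilon>"]) simp
qed

end
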